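(* Let $Q\ge 0$ be an integer, let $\sigma_0,\dots,\sigma_Q>0$, let $\sigma_{\min}=\min_{0\le q\le Q}\sigma_q>0$, and let $\lambda=(\lambda_0,\dots,\lambda_Q)$ with $\lambda_q\ge 0$ and $\sum_{q=0}^{Q}\lambda_q=1$. Let $k_\lambda=\sum_{q=0}^Q\lambda_q k_{H_q}$ be the convex combination of sliced Wasserstein kernels with bandwidths $\sigma_0,\dots,\sigma_Q$, and let $d_{k_\lambda}$ be the RKHS metric it induces. Then for all $D_n,D_m\in\mathcal{D}_b^f(Q)$, $$d_{k_\lambda}^2(D_n,D_m)\ \le\ \frac{2\sqrt2}{\sigma_{\min}^2}\sum_{q=0}^{Q}\lambda_q\,d_1^{(q)}\big(D_n^{(q)},D_m^{(q)}\big).$$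
   Context: **Diagrams.** Let $\Delta=\{(x,x): x>0\}$ be the diagonal and let $\pi_\Delta$ denote orthogonal projection onto the diagonal, $\pi_\Delta(x,y)=(\frac{x+y}{2},\frac{x+y}{2})$. A persistence diagram is a multiset of points of $\{(x,y): x>0,\,y>0\}\setminus\Delta$; it is finite and bounded if it has finitely many points (with multiplicity) contained in a bounded set. $\mathcal{D}_b^f(Q)$ is the set of finite bounded persistence diagrams $D$ whose points are graded by homology dimension and which have no points in dimension larger than $Q$; thus $D$ is given by its restrictions $D^{(0)},\dots,D^{(Q)}$, where $D^{(q)}$ is the (possibly empty) finite bounded persistence diagram formed by the points of $D$ coming from the $q$-th homology group. **Diagram distance.** For finite bounded diagrams $D_1,D_2$, a partial matching is a bijection $\gamma:A\to B$ between sub-multisets $A\subseteq D_1$, $B\subseteq D_2$. Its cost is $c(\gamma)=\sum_{x\in A}\|x-\gamma(x)\|_\infty+\sum_{y}\|y-\pi_\Delta(y)\|_\infty$, where the second sum runs over the unmatched points, i.e. those of $D_1\setminus A$ and $D_2\setminus B$ (with multiplicity). Put $d_1(D_1,D_2)=\inf_\gamma c(\gamma)$. Write $d_1^{(q)}$ for $d_1$ applied to the dimension-$q$ diagrams. **Sliced Wasserstein distance.** For an angle $\theta$, let $\pi_\theta:\mathbb{R}^2\to\mathbb{R}$, $\pi_\theta(p)=\langle p,(\cos\theta,\sin\theta)\rangle$. For finite bounded diagrams $D_1,D_2$ set $\mu_i^\theta=\sum_{p\in D_i}\delta_{\pi_\theta(p)}$ and $\mu_{i\Delta}^\theta=\sum_{p\in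 D_i}\delta_{\pi_\theta(\pi_\Delta(p))}$ (with multiplicity), and $$\mathrm{SW}(D_1,D_2)=\frac1\pi\int_{-\pi/2}^{\pi/2}\mathcal{W}_1\big(\mu_1^\theta+\mu_{2\Delta}^\theta,\ \mu_2^\theta+\mu_{1\Delta}^\theta\big)\,d\theta,$$ where $\mathcal{W}_1$ is the $1$-Wasserstein distance (infimum over couplings of $\int|x-y|$, no normalization) between non-negative measures on $\mathbb{R}$ of equal total mass. **Kernels.** For $D,D'\in\mathcal{D}_b^f(Q)$, $k_{H_q}(D,D')=\exp\big(-\mathrm{SW}(D^{(q)},D'^{(q)})/(2\sigma_q^2)\big)$ and $k_\lambda(D,D')=\sum_{q=0}^Q\lambda_q k_{H_q}(D,D')$. **RKHS metric.** A positive definite kernel $k$ with feature map $\phi$ into its RKHS $\mathcal{H}_k$ induces $d_k(x,y)=\|\phi(x)-\phi(y)\|_{\mathcal{H}_k}$, equivalently $d_k^2(x,y)=k(x,x)-2k(x,y)+k(y,y)$. *)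

theory Defs
  imports "HOL-Probability.Probability"
begin

section \<open>Persistence diagrams\<close>

type_synonym diagram = "(real \<times> real) multiset"

text \<open>Isabelle multisets are finite, so finiteness and boundedness of a diagram are automatic.\<close>

definition is_diagram :: "diagram \<Rightarrow> bool" where
  "is_diagram D \<longleftrightarrow> (\<forall>(x, y) \<in># D. x > 0 \<and> y > 0 \<and> x \<noteq> y)"

definition graded_diagrams :: "nat \<Rightarrow> (nat \<Rightarrow> diagram) set" where
  "graded_diagrams Q = {D. (\<forall>q\<le>Q. is_diagram (D q)) \<and> (\<forall>q>Q. D q = {#})}"

definition diag_proj :: "real \<times> real \<Rightarrow> real \<times> real" where
  "diag_proj p = ((fst p + snd p) / 2, (fst p + snd p) / 2)"


section \<open>Diagram distance\<close>

text \<open>A bijection between sub-multisets \<open>A \<subseteq># D1\<close> and \<open>B \<subseteq># D2\<close> is encoded by its graph,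
  a multiset of pairs whose two projections are \<open>A\<close> and \<open>B\<close>.\<close>

definition partial_matchings ::
    "diagram \<Rightarrow> diagram \<Rightarrow> ((real \<times> real) \<times> (real \<times> real)) multiset set" where
  "partial_matchings D1 D2 = {M. image_mset fst M \<subseteq># D1 \<and> image_mset snd M \<subseteq># D2}"

definition matching_cost ::
    "diagram \<Rightarrow> diagram \<Rightarrow> ((real \<times> real) \<times> (real \<times> real)) multiset \<Rightarrow> real" where
  "matching_cost D1 D2 M =
     (\<Sum>(p, p') \<in># M. infnorm (p - p')) +
     (\<Sum>p \<in># (D1 - image_mset fst M) + (D2 - image_mset snd M). infnorm (p - diag_proj p))"

definition diagram_dist :: "diagram \<Rightarrow> diagram \<Rightarrow> real" where
  "diagram_dist D1 D2 = (INF M \<in> partial_matchings D1 D2. matching_cost D1 D2 M)"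


section \<open>Sliced Wasserstein distance\<close>

text \<open>The sum of the Dirac measures at the elements of a multiset, with multiplicity.
  A sum of two such measures is the measure of the multiset sum.\<close>

definition dirac_sum :: "real multiset \<Rightarrow> real measure" where
  "dirac_sum X = measure_of UNIV (sets borel) (\<lambda>A. \<Sum>x \<in># X. emeasure (return borel x) A)"

lemma sets_dirac_sum [simp, measurable_cong]: "sets (dirac_sum X) = sets borel"
  unfolding dirac_sum_def using sets.sets_measure_of_eq[of "borel :: real measure"] by simp

lemma space_dirac_sum [simp]: "space (dirac_sum X) = UNIV"
  by (metis sets_dirac_sum sets_eq_imp_space_eq space_borel)

lemma emeasure_dirac_sum:
  assumes "A \<in> sets borel"
  shows "emeasure (dirac_sum X) A = (\<Sum>x \<in># X. emeasure (return borel x) A)"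
proof (rule emeasure_measure_of[OF dirac_sum_def])
  show "positive (sets (dirac_sum X)) (\<lambda>A. \<Sum>x \<in># X. emeasure (return borel x) A)"
    by (simp add: positive_def)
  show "countably_additive (sets (dirac_sum X)) (\<lambda>A. \<Sum>x \<in># X. emeasure (return borel x) A)"
  proof (rule countably_additiveI)
    fix F :: "nat \<Rightarrow> real set"
    assume F: "range F \<subseteq> sets (dirac_sum X)" "disjoint_family F"
    show "(\<Sum>i. \<Sum>x \<in># X. emeasure (return borel x) (F i)) =
          (\<Sum>x \<in># X. emeasure (return borel x) (\<Union> (range F)))"
    proof (induction X)
      case empty
      then show ?case by simp
    next
      case (add a X)
      have "(\<Sum>i. emeasure (return borel a) (F i)) = emeasure (return borel a) (\<Union> (range F))"
        by (rule suminf_emeasure) (use F in auto)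
      then show ?case using add by (simp add: suminf_add[symmetric])
    qed
  qed
qed (use assms in auto)

definition couplings :: "real measure \<Rightarrow> real measure \<Rightarrow> (real \<times> real) measure set" where
  "couplings \<mu> \<nu> = {\<gamma>. sets \<gamma> = sets (borel \<Otimes>\<^sub>M borel) \<and>
                      distr \<gamma> borel fst = \<mu> \<and> distr \<gamma> borel snd = \<nu>}"

definition wasserstein1 :: "real measure \<Rightarrow> real measure \<Rightarrow> real" where
  "wasserstein1 \<mu> \<nu> =
     enn2real (INF \<gamma> \<in> couplings \<mu> \<nu>. \<integral>\<^sup>+ z. ennreal \<bar>fst z - snd z\<bar> \<partial>\<gamma>)"

definition line_proj :: "real \<Rightarrow> real \<times> real \<Rightarrow> real" where
  "line_proj \<theta> p = p \<bullet> (cos \<theta>, sin \<theta>)"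

definition sliced_measure :: "real \<Rightarrow> diagram \<Rightarrow> diagram \<Rightarrow> real measure" where
  "sliced_measure \<theta> D1 D2 =
     dirac_sum (image_mset (line_proj \<theta>) D1 + image_mset (line_proj \<theta> \<circ> diag_proj) D2)"

definition sliced_wasserstein :: "diagram \<Rightarrow> diagram \<Rightarrow> real" where
  "sliced_wasserstein D1 D2 =
     1 / pi * (LBINT \<theta>:{- pi / 2..pi / 2}.
                 wasserstein1 (sliced_measure \<theta> D1 D2) (sliced_measure \<theta> D2 D1))"


section \<open>Kernels and the RKHS metric\<close>

definition sw_kernel :: "real \<Rightarrow> diagram \<Rightarrow> diagram \<Rightarrow> real" where
  "sw_kernel s D D' = exp (- sliced_wasserstein D D' / (2 * s\<^sup>2))"

definition mixed_kernel ::
    "nat \<Rightarrow> (nat \<Rightarrow> real) \<Rightarrow> (nat \<Rightarrow> real) \<Rightarrow>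
     (nat \<Rightarrow> diagram) \<Rightarrow> (nat \<Rightarrow> diagram) \<Rightarrow> real" where
  "mixed_kernel Q \<sigma> lam D D' = (\<Sum>q\<le>Q. lam q * sw_kernel (\<sigma> q) (D q) (D' q))"

text \<open>The Hilbert space \<open>'h\<close> is the RKHS of the kernel \<open>k\<close> on \<open>X\<close>, with canonical feature map
  \<open>\<phi>\<close>. A vector \<open>h\<close> is identified with the function \<open>\<lambda>x. h \<bullet> \<phi> x\<close> on \<open>X\<close>: the reproducing
  property is then built in, \<open>\<phi> y\<close> is the kernel section \<open>k y\<close> by the first conjunct,
  and the second conjunct says that the identification is injective, i.e. that \<open>'h\<close> is
  a space of functions on \<open>X\<close>.\<close>

definition rkhs_feature_map ::
    "'x set \<Rightarrow> ('x \<Rightarrow> 'x \<Rightarrow> real) \<Rightarrow> ('x \<Rightarrow> 'h :: {real_inner, complete_space}) \<Rightarrow> bool" where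
  "rkhs_feature_map X k \<phi> \<longleftrightarrow>
     (\<forall>x\<in>X. \<forall>y\<in>X. \<phi> x \<bullet> \<phi> y = k x y) \<and>
     (\<forall>h. (\<forall>x\<in>X. h \<bullet> \<phi> x = 0) \<longrightarrow> h = 0)"

definition rkhs_dist :: "('x \<Rightarrow> 'h :: {real_inner, complete_space}) \<Rightarrow> 'x \<Rightarrow> 'x \<Rightarrow> real" where
  "rkhs_dist \<phi> x y = norm (\<phi> x - \<phi> y)"

end

(* Any partial matching M of D1 and D2 yields, for every angle, a coupling of the sliced measures:
   transport p to p' and the diagonal projection of p' to that of p for every matched pair (p, p'),
   and transport along the segment between p and its diagonal projection for every unmatched p.
   Projections onto lines are contractions for the Euclidean norm, which is at most sqrt 2 times the
   supremum norm, so this coupling costs at most 2 sqrt 2 times M.  Averaging over the angle gives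
   SW \<le> 2 sqrt 2 d_1, and the theorem follows from 1 - exp (- t) \<le> t. *)
theory Submission imports Defs begin

text \<open>The unit masses at the pairs in \<open>Z\<close> form a coupling of the two measures,
  and its cost is the right-hand side, which therefore bounds the infimum.\<close>

lemma wasserstein1_dirac_sum_le:
  fixes Z :: "(real \<times> real) multiset"
  shows "wasserstein1 (dirac_sum (image_mset fst Z)) (dirac_sum (image_mset snd Z))
           \<le> (\<Sum>z\<in>#Z. \<bar>fst z - snd z\<bar>)"
proof -
  obtain zs where Z: "Z = mset zs" by (metis ex_mset)
  have sum_Z: "(\<Sum>z\<in>#Z. f z) = (\<Sum>i<length zs. f (zs ! i))"
    for f :: "real \<times> real \<Rightarrow> 'b::comm_monoid_add"
    unfolding Z mset_map[symmetric] sum_mset_sum_list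
    by (simp add: sum_list_sum_nth atLeast0LessThan)
  \<comment> \<open>Pushing forward counting measure on the indices, not on the set of pairs, keeps
    repeated pairs with their multiplicity and turns integrals into finite sums.\<close>
  define \<gamma> where "\<gamma> = distr (count_space {..<length zs}) (borel \<Otimes>\<^sub>M borel) ((!) zs)"
  have nn_integral_\<gamma>: "(\<integral>\<^sup>+ z. f z \<partial>\<gamma>) = (\<Sum>i<length zs. f (zs ! i))"
    if [measurable]: "f \<in> borel_measurable (borel \<Otimes>\<^sub>M borel)" for f
  proof -
    have "(\<integral>\<^sup>+ z. f z \<partial>\<gamma>) = (\<integral>\<^sup>+ i. f (zs ! i) \<partial>count_space {..<length zs})"
      unfolding \<gamma>_def by (rule nn_integral_distr) (simp_all add: space_pair_measure)
    then show ?thesis by (simp add: nn_integral_count_space_finite)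
  qed
  have marginal: "distr \<gamma> borel g = dirac_sum (image_mset g Z)"
    if [measurable]: "g \<in> borel_measurable (borel \<Otimes>\<^sub>M borel)" for g :: "real \<times> real \<Rightarrow> real"
  proof (rule measure_eqI)
    fix A assume "A \<in> sets (distr \<gamma> borel g)"
    then have A [measurable]: "A \<in> sets borel" by simp
    have "emeasure (distr \<gamma> borel g) A = (\<integral>\<^sup>+ x. indicator A x \<partial>distr \<gamma> borel g)"
      by simp
    also have "\<dots> = (\<integral>\<^sup>+ x. indicator A (g x) \<partial>\<gamma>)"
      by (rule nn_integral_distr) (simp_all add: \<gamma>_def)
    also have "\<dots> = (\<Sum>i<length zs. indicator A (g (zs ! i)))"
      by (rule nn_integral_\<gamma>) measurable
    also have "\<dots> = emeasure (dirac_sum (image_mset g Z)) A"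
      by (simp add: emeasure_dirac_sum emeasure_return multiset.map_comp comp_def sum_Z)
    finally show "emeasure (distr \<gamma> borel g) A = emeasure (dirac_sum (image_mset g Z)) A" .
  qed simp
  have "\<gamma> \<in> couplings (dirac_sum (image_mset fst Z)) (dirac_sum (image_mset snd Z))"
    unfolding couplings_def by (simp add: marginal) (simp add: \<gamma>_def)
  then have "(INF \<gamma> \<in> couplings (dirac_sum (image_mset fst Z)) (dirac_sum (image_mset snd Z)).
      \<integral>\<^sup>+ z. ennreal \<bar>fst z - snd z\<bar> \<partial>\<gamma>) \<le> (\<integral>\<^sup>+ z. ennreal \<bar>fst z - snd z\<bar> \<partial>\<gamma>)"
    by (rule INF_lower)
  also have "\<dots> = (\<Sum>i<length zs. ennreal \<bar>fst (zs ! i) - snd (zs ! i)\<bar>)"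
    by (rule nn_integral_\<gamma>) measurable
  also have "\<dots> = ennreal (\<Sum>z\<in>#Z. \<bar>fst z - snd z\<bar>)"
    by (simp add: sum_Z)
  finally show ?thesis
    unfolding wasserstein1_def by (intro enn2real_leI) (auto simp: sum_Z intro: sum_nonneg)
qed

text \<open>For p = (x, y) the squared norms differ by (x - y)^2 / 2.\<close>

lemma norm_diag_proj_le: "norm (diag_proj p) \<le> norm p"
proof -
  have "((fst p + snd p) / 2)\<^sup>2 + ((fst p + snd p) / 2)\<^sup>2 \<le> (fst p)\<^sup>2 + (snd p)\<^sup>2"
    using zero_le_power2[of "fst p - snd p"] by (simp add: power2_eq_square field_simps)
  then show ?thesis by (simp add: diag_proj_def norm_prod_def power_divide)
qed

lemma abs_line_proj_le: "\<bar>line_proj \<theta> p\<bar> \<le> norm p"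
  using Cauchy_Schwarz_ineq2[of p "(cos \<theta>, sin \<theta>)"]
  by (simp add: line_proj_def norm_prod_def)

lemma norm_le_sqrt2_infnorm: "norm p \<le> sqrt 2 * infnorm p" for p :: "real \<times> real"
  using norm_le_infnorm[of p] by simp

lemma line_proj_diff: "line_proj \<theta> p - line_proj \<theta> q = line_proj \<theta> (p - q)"
  by (simp add: line_proj_def inner_diff_left)

lemma diag_proj_diff: "diag_proj p - diag_proj q = diag_proj (p - q)"
  by (simp add: diag_proj_def field_simps)

lemma abs_line_proj_diff_le:
  "\<bar>line_proj \<theta> p - line_proj \<theta> q\<bar> \<le> sqrt 2 * infnorm (p - q)"
  unfolding line_proj_diff using abs_line_proj_le norm_le_sqrt2_infnorm order_trans by blast

lemma abs_line_diag_proj_diff_le: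
  "\<bar>line_proj \<theta> (diag_proj p) - line_proj \<theta> (diag_proj q)\<bar> \<le> sqrt 2 * infnorm (p - q)"
  unfolding line_proj_diff diag_proj_diff
  using abs_line_proj_le norm_diag_proj_le norm_le_sqrt2_infnorm order_trans by meson

lemma wasserstein1_sliced_le_matching_cost:
  assumes "M \<in> partial_matchings D1 D2"
  shows "wasserstein1 (sliced_measure \<theta> D1 D2) (sliced_measure \<theta> D2 D1)
           \<le> 2 * sqrt 2 * matching_cost D1 D2 M"
proof -
  define U1 U2 where "U1 = D1 - image_mset fst M" and "U2 = D2 - image_mset snd M"
  \<comment> \<open>Multiset subtraction truncates; the inclusions in
    \<open>partial_matchings\<close> make \<open>U1\<close> and \<open>U2\<close> true
    complements.\<close>
  have D1: "D1 = image_mset fst M + U1" and D2: "D2 = image_mset snd M + U2"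
    using assms by (simp_all add: partial_matchings_def U1_def U2_def)
  let ?l = "line_proj \<theta>" and ?d = "\<lambda>p. line_proj \<theta> (diag_proj p)"
  \<comment> \<open>First components must add up to \<open>D1\<close> together with the projected
    \<open>D2\<close>. Hence the second and fourth families start at the diagonal projections of
    points of \<open>D2\<close>.\<close>
  define Z where "Z = {#(?l (fst m), ?l (snd m)). m \<in># M#} + {#(?d (snd m), ?d (fst m)). m \<in># M#}
    + {#(?l p, ?d p). p \<in># U1#} + {#(?d p, ?l p). p \<in># U2#}"
  have "wasserstein1 (sliced_measure \<theta> D1 D2) (sliced_measure \<theta> D2 D1)
      = wasserstein1 (dirac_sum (image_mset fst Z)) (dirac_sum (image_mset snd Z))"
    unfolding sliced_measure_def D1 D2 Z_def
    by (simp add: multiset.map_comp comp_def ac_simps)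
  also have "\<dots> \<le> (\<Sum>z\<in>#Z. \<bar>fst z - snd z\<bar>)"
    by (rule wasserstein1_dirac_sum_le)
  also have "\<dots> = (\<Sum>m\<in>#M. \<bar>?l (fst m) - ?l (snd m)\<bar> + \<bar>?d (fst m) - ?d (snd m)\<bar>)
      + (\<Sum>p\<in>#U1 + U2. \<bar>?l p - ?d p\<bar>)"
    by (simp add: Z_def multiset.map_comp comp_def sum_mset.distrib abs_minus_commute ac_simps)
  \<comment> \<open>A matched pair pays sqrt 2 times its distance twice, for the points and for
    their projections. An unmatched point pays once; its bound is doubled to get a common
    factor.\<close>
  also have "\<dots> \<le> (\<Sum>m\<in>#M. 2 * sqrt 2 * infnorm (fst m - snd m))
      + (\<Sum>p\<in>#U1 + U2. 2 * sqrt 2 * infnorm (p - diag_proj p))"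
  proof (intro add_mono sum_mset_mono)
    fix m
    show "\<bar>?l (fst m) - ?l (snd m)\<bar> + \<bar>?d (fst m) - ?d (snd m)\<bar> \<le> 2 * sqrt 2 * infnorm (fst m - snd m)"
      using abs_line_proj_diff_le[of \<theta> "fst m" "snd m"]
        abs_line_diag_proj_diff_le[of \<theta> "fst m" "snd m"] by simp
  next
    fix p
    have "0 \<le> sqrt 2 * infnorm (p - diag_proj p)"
      by (simp add: infnorm_pos_le)
    then show "\<bar>?l p - ?d p\<bar> \<le> 2 * sqrt 2 * infnorm (p - diag_proj p)"
      using abs_line_proj_diff_le[of \<theta> p "diag_proj p"] by simp
  qed
  also have "\<dots> = 2 * sqrt 2 * matching_cost D1 D2 M"
    by (simp add: matching_cost_def U1_def U2_def case_prod_unfold sum_mset_distrib_left algebra_simps)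
  finally show ?thesis .
qed

text \<open>\<open>enn2real\<close> is nonnegative, and so is the Bochner integral of a nonnegative
  function, with value 0 if it is not integrable.\<close>

lemma sliced_wasserstein_nonneg: "0 \<le> sliced_wasserstein D1 D2"
  unfolding sliced_wasserstein_def set_lebesgue_integral_def
  by (intro mult_nonneg_nonneg integral_nonneg) (auto simp: wasserstein1_def)

lemma sum_mset_nonneg:
  fixes f :: "'a \<Rightarrow> 'b::ordered_comm_monoid_add"
  assumes "\<And>x. 0 \<le> f x"
  shows "0 \<le> (\<Sum>x\<in>#X. f x)"
  by (induction X) (auto intro: add_nonneg_nonneg assms)

lemma matching_cost_nonneg: "0 \<le> matching_cost D1 D2 M"
  unfolding matching_cost_def case_prod_unfold
  by (intro add_nonneg_nonneg sum_mset_nonneg infnorm_pos_le)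

lemma sliced_wasserstein_le_matching_cost:
  assumes "M \<in> partial_matchings D1 D2"
  shows "sliced_wasserstein D1 D2 \<le> 2 * sqrt 2 * matching_cost D1 D2 M"
proof -
  let ?W = "\<lambda>\<theta>. wasserstein1 (sliced_measure \<theta> D1 D2) (sliced_measure \<theta> D2 D1)"
  let ?c = "2 * sqrt 2 * matching_cost D1 D2 M"
  have "(LBINT \<theta>:{- pi / 2..pi / 2}. ?W \<theta>) \<le> (LBINT \<theta>:{- pi / 2..pi / 2}. ?c)"
    unfolding set_lebesgue_integral_def
  \<comment> \<open>This rule asks for integrability of the constant majorant only: a nonintegrable
    left side would have integral 0, below the integral of the nonnegative majorant.\<close>
  proof (rule integral_mono')
    show "integrable lborel (\<lambda>\<theta>. indicat_real {- pi / 2..pi / 2} \<theta> *\<^sub>R ?c)" by simp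
    show "indicat_real {- pi / 2..pi / 2} \<theta> *\<^sub>R ?W \<theta> \<le> indicat_real {- pi / 2..pi / 2} \<theta> *\<^sub>R ?c" for \<theta>
      using wasserstein1_sliced_le_matching_cost[OF assms] by (simp add: mult_left_mono)
    show "0 \<le> indicat_real {- pi / 2..pi / 2} \<theta> *\<^sub>R ?c" for \<theta>
      by (simp add: matching_cost_nonneg)
  qed
  \<comment> \<open>The interval has length pi, which cancels the averaging factor 1 / pi.\<close>
  also have "\<dots> = pi * ?c"
    by (simp add: set_lebesgue_integral_def)
  finally show ?thesis
    by (simp add: sliced_wasserstein_def divide_simps mult.commute)
qed

lemma sliced_wasserstein_le_diagram_dist:
  "sliced_wasserstein D1 D2 \<le> 2 * sqrt 2 * diagram_dist D1 D2"
proof -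
  \<comment> \<open>The empty matching makes the index set nonempty, as a lower bound on a real
    infimum requires.\<close>
  have "{#} \<in> partial_matchings D1 D2"
    by (simp add: partial_matchings_def)
  then have "sliced_wasserstein D1 D2 / (2 * sqrt 2) \<le> diagram_dist D1 D2"
    unfolding diagram_dist_def
    using sliced_wasserstein_le_matching_cost[of _ D1 D2]
    by (intro cINF_greatest) (auto simp: divide_simps mult.commute)
  then show ?thesis by (simp add: divide_simps mult.commute)
qed

lemma sw_kernel_le_1: "sw_kernel s D1 D2 \<le> 1"
  by (simp add: sw_kernel_def sliced_wasserstein_nonneg)

text \<open>This is 1 - exp (- t) \<le> t at t = SW / (2 s^2); the 2 in the bandwidth halves the
  constant 2 sqrt 2.\<close>

lemma one_minus_sw_kernel_le:
  "1 - sw_kernel s D1 D2 \<le> sqrt 2 / s\<^sup>2 * diagram_dist D1 D2"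
proof -
  have "1 - sw_kernel s D1 D2 \<le> sliced_wasserstein D1 D2 / (2 * s\<^sup>2)"
    using exp_ge_add_one_self[of "- sliced_wasserstein D1 D2 / (2 * s\<^sup>2)"]
    by (simp add: sw_kernel_def)
  also have "\<dots> \<le> 2 * sqrt 2 * diagram_dist D1 D2 / (2 * s\<^sup>2)"
    by (intro divide_right_mono sliced_wasserstein_le_diagram_dist) simp
  finally show ?thesis by simp
qed

lemma diagram_dist_nonneg: "0 \<le> diagram_dist D1 D2"
  using order_trans[OF sliced_wasserstein_nonneg sliced_wasserstein_le_diagram_dist, of D1 D2]
  by (simp add: zero_le_mult_iff)

theorem theorem3p4:
  fixes Q :: nat
    and \<sigma> lam :: "nat \<Rightarrow> real"
    and \<phi> :: "(nat \<Rightarrow> diagram) \<Rightarrow> 'h :: {real_inner, complete_space}"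
    and Dn Dm :: "nat \<Rightarrow> diagram"
  assumes "\<And>q. q \<le> Q \<Longrightarrow> \<sigma> q > 0"
    and "\<And>q. q \<le> Q \<Longrightarrow> lam q \<ge> 0"
    and "(\<Sum>q\<le>Q. lam q) = 1"
    and "rkhs_feature_map (graded_diagrams Q) (mixed_kernel Q \<sigma> lam) \<phi>"
    and "Dn \<in> graded_diagrams Q"
    and "Dm \<in> graded_diagrams Q"
  shows "(rkhs_dist \<phi> Dn Dm)\<^sup>2 \<le>
           2 * sqrt 2 / (Min (\<sigma> ` {..Q}))\<^sup>2 * (\<Sum>q\<le>Q. lam q * diagram_dist (Dn q) (Dm q))"
proof -
  let ?k = "mixed_kernel Q \<sigma> lam" and ?s = "Min (\<sigma> ` {..Q})"
  have inner: "\<phi> x \<bullet> \<phi> y = ?k x y" if "x \<in> graded_diagrams Q" "y \<in> graded_diagrams Q" for x y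
    using assms(4) that by (simp add: rkhs_feature_map_def)
  have diagonal: "?k D D \<le> 1" for D
  proof -
    have "?k D D \<le> (\<Sum>q\<le>Q. lam q)"
      unfolding mixed_kernel_def
      by (intro sum_mono mult_left_le) (auto simp: assms(2) sw_kernel_le_1)
    then show ?thesis by (simp add: assms(3))
  qed
  have s_pos: "0 < ?s" using assms(1) by simp
  \<comment> \<open>The two cross terms merge by symmetry of the inner product, so symmetry of the
    sliced Wasserstein distance is never computed.\<close>
  have "(rkhs_dist \<phi> Dn Dm)\<^sup>2 = ?k Dn Dn - 2 * ?k Dn Dm + ?k Dm Dm"
    using assms(5,6) inner_commute[of "\<phi> Dm" "\<phi> Dn"]
    by (simp add: rkhs_dist_def power2_norm_eq_inner inner_diff_left inner_diff_right inner)
  also have "\<dots> \<le> 2 * (1 - ?k Dn Dm)"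
    using diagonal[of Dn] diagonal[of Dm] by simp
  \<comment> \<open>Since the weights sum to 1, the constant 1 can be spread over the
    dimensions.\<close>
  also have "1 - ?k Dn Dm = (\<Sum>q\<le>Q. lam q * (1 - sw_kernel (\<sigma> q) (Dn q) (Dm q)))"
    by (simp add: mixed_kernel_def right_diff_distrib sum_subtractf assms(3))
  also have "\<dots> \<le> (\<Sum>q\<le>Q. lam q * (sqrt 2 / ?s\<^sup>2 * diagram_dist (Dn q) (Dm q)))"
  proof (intro sum_mono mult_left_mono)
    fix q assume q: "q \<in> {..Q}"
    then have "?s \<le> \<sigma> q" "0 < \<sigma> q" using assms(1) by simp_all
    \<comment> \<open>Passing to the smallest bandwidth only enlarges the coefficient; nonnegativity
      of \<open>diagram_dist\<close> carries this over to the product.\<close>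
    then have "sqrt 2 / (\<sigma> q)\<^sup>2 \<le> sqrt 2 / ?s\<^sup>2"
      using s_pos by (intro divide_left_mono power_mono mult_pos_pos zero_less_power)
        (simp_all only: real_sqrt_ge_0_iff less_imp_le zero_le_numeral)
    then show "1 - sw_kernel (\<sigma> q) (Dn q) (Dm q) \<le> sqrt 2 / ?s\<^sup>2 * diagram_dist (Dn q) (Dm q)"
      by (rule order_trans[OF one_minus_sw_kernel_le mult_right_mono[OF _ diagram_dist_nonneg]])
    show "0 \<le> lam q" using q assms(2) by simp
  qed
  finally show ?thesis
    by (simp add: sum_distrib_left sum_divide_distrib mult_ac)
qed

end
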